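(* Let $G=(V,w,\mu)$ be a connected finite weighted graph with symmetric edge weights $w$ and vertex measure $\mu\in\mathcal{M}^*(V)$, and let $\deg$ denote its vertex degree. Then for any $\nu\in\mathcal{M}(V)$, $$\lambda_2\ \ge\ \frac12\, h(\mu,\nu)\, h(\deg,\nu),$$ where $\lambda_2$ is the second smallest eigenvalue (counted with multiplicity) of the Laplacian $\Delta_{w,\mu}$.
   Context: $V$ is a finite set with $|V|\ge 2$. $\mathcal{M}(V)=\{\nu:V\to[0,\infty)\}$ and $\mathcal{M}^*(V)=\{\nu:V\to(0,\infty)\}$; for $\nu\in\mathcal{M}(V)$ and $A\subset V$ put $\nu(A)=\sum_{x\in A}\nu(x)$. A finite weighted graph $G=(V,w,\mu)$ consists of symmetric edge weights $w:V\times V\to[0,\infty)$, $w(x,y)=w(y,x)$, $w(x,x)=0$, and a vertex measure $\mu\in\mathcal{M}^*(V)$; $x,y$ are joined by an edge iff $w(x,y)>0$, and $G$ is connected if this graph is connected. For $A,B\subset V$: $A^c=V\setminus A$ and $w(A,B)=\sum_{x\in A,\,y\in B}w(x,y)$. The vertex degree is the measure $\deg\in\mathcal{M}(V)$, $\deg(x)=\sum_{y\ne x}w(x,y)$. The Laplacian is $$\Delta_{w,\mu}f(x)=\frac1{\mu(x)}\sum_{y\in V}w(x,y)(f(x)-f(y));$$ it is symmetric for the inner product $\langle f_1,f_2\rangle_\mu=\sum_x\mu(x)f_1(x)\overline{f_2(x)}$ and has real non-negative eigenvalues $0=\lambda_1\le\lambda_2\le\cdots\le\lambda_{|V|}$,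 counted with multiplicity. For $\mu\in\mathcal{M}^*(V)$ and $\nu\in\mathcal{M}(V)$ the generalized Cheeger constant is $$h(\mu,\nu)=\inf_{\substack{\emptyset\ne A\subset V:\\ \nu(A)\le\nu(V)/2}}\frac{w(A,A^c)}{\mu(A)}.$$ $h(\deg,\nu)$ is the same expression with $\mu$ replaced by $\deg$ (and the same edge weights $w$). *)

theory Defs
  imports "HOL-Analysis.Analysis"
begin

text \<open>The finite vertex set \<open>V\<close> is the universe of a type \<open>'v\<close> of class \<open>finite\<close>.\<close>

locale weighted_graph =
  fixes w :: "'v::finite \<Rightarrow> 'v \<Rightarrow> real" and \<mu> :: "'v \<Rightarrow> real"
  assumes card_vertices: "CARD('v) \<ge> 2"
    and weight_nonneg: "w x y \<ge> 0"
    and weight_sym: "w x y = w y x"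
    and weight_refl: "w x x = 0"
    and measure_pos: "\<mu> x > 0"

definition graph_connected :: "('v \<Rightarrow> 'v \<Rightarrow> real) \<Rightarrow> bool" where
  "graph_connected w \<longleftrightarrow> (\<forall>x y. (\<lambda>u v. w u v > 0)\<^sup>*\<^sup>* x y)"

definition vertex_degree :: "('v::finite \<Rightarrow> 'v \<Rightarrow> real) \<Rightarrow> 'v \<Rightarrow> real" where
  "vertex_degree w x = (\<Sum>y\<in>UNIV - {x}. w x y)"

definition cut_weight :: "('v::finite \<Rightarrow> 'v \<Rightarrow> real) \<Rightarrow> 'v set \<Rightarrow> 'v set \<Rightarrow> real" where
  "cut_weight w A B = (\<Sum>x\<in>A. \<Sum>y\<in>B. w x y)"

text \<open>If \<open>\<nu>\<close> vanishes identically then \<open>A = UNIV\<close> is admissible and the constant is \<open>0\<close>.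
  As long as there are at least two vertices, some singleton is admissible, so the
  infimum is over a nonempty finite set of reals.\<close>

definition cheeger ::
  "('v::finite \<Rightarrow> 'v \<Rightarrow> real) \<Rightarrow> ('v \<Rightarrow> real) \<Rightarrow> ('v \<Rightarrow> real) \<Rightarrow> real" where
  "cheeger w \<mu> \<nu> =
     (INF A\<in>{A. A \<noteq> {} \<and> sum \<nu> A \<le> sum \<nu> UNIV / 2}. cut_weight w A (- A) / sum \<mu> A)"

definition laplacian ::
  "('v::finite \<Rightarrow> 'v \<Rightarrow> real) \<Rightarrow> ('v \<Rightarrow> real) \<Rightarrow> complex ^ 'v \<Rightarrow> complex ^ 'v" where
  "laplacian w \<mu> f =
     (\<chi> x. 1 / of_real (\<mu> x) * (\<Sum>y\<in>UNIV. of_real (w x y) * (f $ x - f $ y)))"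

definition eigenspace ::
  "('v::finite \<Rightarrow> 'v \<Rightarrow> real) \<Rightarrow> ('v \<Rightarrow> real) \<Rightarrow> real \<Rightarrow> (complex ^ 'v) set" where
  "eigenspace w \<mu> t = {f. laplacian w \<mu> f = of_real t *s f}"

text \<open>For symmetric \<open>w\<close> and positive \<open>\<mu>\<close> the Laplacian is self-adjoint for the inner product
  weighted by \<open>\<mu>\<close>. So it has only real eigenvalues, and the multiplicity of an eigenvalue is
  the complex dimension \<open>vec.dim\<close> of its eigenspace (algebraic and geometric
  multiplicities agree); the list below then has length \<open>CARD('v)\<close>.\<close>

definition laplacian_spectrum :: "('v::finite \<Rightarrow> 'v \<Rightarrow> real) \<Rightarrow> ('v \<Rightarrow> real) \<Rightarrow> real set" where
  "laplacian_spectrum w \<mu> = {t. \<exists>f \<in> eigenspace w \<mu> t. f \<noteq> 0}"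

definition eigenvalue_list :: "('v::finite \<Rightarrow> 'v \<Rightarrow> real) \<Rightarrow> ('v \<Rightarrow> real) \<Rightarrow> real list" where
  "eigenvalue_list w \<mu> =
     concat (map (\<lambda>t. replicate (vec.dim (eigenspace w \<mu> t)) t)
       (sorted_list_of_set (laplacian_spectrum w \<mu>)))"

text \<open>The \<open>k\<close>-th smallest eigenvalue, where \<open>k\<close> starts at 1.\<close>

definition laplacian_eigenvalue ::
  "('v::finite \<Rightarrow> 'v \<Rightarrow> real) \<Rightarrow> ('v \<Rightarrow> real) \<Rightarrow> nat \<Rightarrow> real" where
  "laplacian_eigenvalue w \<mu> k = eigenvalue_list w \<mu> ! (k - 1)"

end

theory Submission
  imports Defs
begin

text \<open>
  Let \<open>f\<close> be a real eigenfunction for \<open>\<lambda>\<^sub>2\<close>, and shift it by a \<open>\<nu>\<close>-median \<open>c\<close>, so that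
  both \<open>f > c\<close> and \<open>f < c\<close> are sets of at most half the \<open>\<nu>\<close>-measure.  The shift leaves the Dirichlet
  energy \<open>E\<close> unchanged, and it cannot decrease the \<open>\<mu>\<close>-norm because \<open>f\<close> is orthogonal to the
  constants; hence \<open>g = f - c\<close> satisfies \<open>E(g) \<le> \<lambda>\<^sub>2 \<parallel>g\<parallel>\<^sup>2\<close>.  On the other hand \<open>E(g) \<ge> E(g\<^sup>+) + E(g\<^sup>-)\<close>, so that it
  is enough to bound \<open>E(u)\<close> below by \<open>1/2 h(\<mu>,\<nu>) h(deg,\<nu>) \<parallel>u\<parallel>\<^sup>2\<close> for every \<open>u \<ge> 0\<close> whose support has
  at most half the \<open>\<nu>\<close>-measure (lemma \<open>dirichlet_ge_cheeger_product\<close>).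

  For such \<open>u\<close> the superlevel sets of \<open>u\<^sup>2\<close> are all admissible in both Cheeger constants.  The co-area
  inequality (lemma \<open>total_variation_ge\<close>) therefore bounds the total variation \<open>Q\<close> of \<open>u\<^sup>2\<close> from below in
  two ways, by \<open>h(\<mu>,\<nu>) \<parallel>u\<parallel>\<^sup>2\<close> and by \<open>h(deg,\<nu>) D\<close>, where \<open>D\<close> is the squared norm of \<open>u\<close> with respect
  to the degree measure.  Cauchy--Schwarz applied to \<open>u(x)\<^sup>2 - u(y)\<^sup>2 = (u(x) - u(y)) (u(x) + u(y))\<close> gives
  \<open>Q\<^sup>2 \<le> 2 E(u) D\<close>.  Using one lower bound for each factor of \<open>Q\<^sup>2\<close> and cancelling \<open>D\<close> yields the claim.

  It remains to see that the second entry of the list of eigenvalues really is a positive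
  eigenvalue with an eigenfunction.  Eigenfunctions of different eigenvalues are orthogonal,
  so the spectrum is finite; connectedness makes \<open>0\<close> a simple eigenvalue; and a
  minimizer of the Rayleigh quotient on the complement of the constants provides a further
  eigenvalue.
\<close>

section \<open>The Dirichlet form\<close>

definition dirichlet :: "('v::finite \<Rightarrow> 'v \<Rightarrow> real) \<Rightarrow> ('v \<Rightarrow> real) \<Rightarrow> ('v \<Rightarrow> real) \<Rightarrow> real" where
  "dirichlet w f g = (\<Sum>x\<in>UNIV. \<Sum>y\<in>UNIV. w x y * ((f x - f y) * (g x - g y))) / 2"

text \<open>The eigenvalue equation is multiplied by \<open>\<mu> x\<close> to avoid division, and \<open>f = 0\<close> is allowed because
  the real or the imaginary part of a complex eigenfunction may vanish.\<close>

definition real_eigenfunction ::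
  "('v::finite \<Rightarrow> 'v \<Rightarrow> real) \<Rightarrow> ('v \<Rightarrow> real) \<Rightarrow> real \<Rightarrow> ('v \<Rightarrow> real) \<Rightarrow> bool" where
  "real_eigenfunction w \<mu> t f \<longleftrightarrow> (\<forall>x. (\<Sum>y\<in>UNIV. w x y * (f x - f y)) = t * (\<mu> x * f x))"

lemma dirichlet_commute: "dirichlet w f g = dirichlet w g f"
  by (simp add: dirichlet_def mult.commute)

lemma dirichlet_shift: "dirichlet w (\<lambda>x. f x - c) (\<lambda>x. f x - c) = dirichlet w f f"
  by (simp add: dirichlet_def)

lemma dirichlet_square_add:
  "dirichlet w (\<lambda>x. f x + t * g x) (\<lambda>x. f x + t * g x)
     = dirichlet w f f + 2 * t * dirichlet w f g + t\<^sup>2 * dirichlet w g g"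
proof -
  have "w x y * ((f x + t * g x - (f y + t * g y)) * (f x + t * g x - (f y + t * g y)))
      = w x y * ((f x - f y) * (f x - f y)) + 2 * t * (w x y * ((f x - f y) * (g x - g y)))
          + t\<^sup>2 * (w x y * ((g x - g y) * (g x - g y)))" for x y
    by (simp add: algebra_simps power2_eq_square)
  then show ?thesis
    by (simp add: dirichlet_def sum.distrib add_divide_distrib flip: sum_distrib_left)
qed

context weighted_graph
begin

lemma two_vertices: "\<exists>a b :: 'v. a \<noteq> b"
  using card_vertices card_le_Suc0_iff_eq[of "UNIV :: 'v set"] by fastforce

lemma sum_swap_weight:
  "(\<Sum>x\<in>UNIV. \<Sum>y\<in>UNIV. w x y * F x y) = (\<Sum>x\<in>UNIV. \<Sum>y\<in>UNIV. w x y * F y x)"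
  by (subst sum.swap) (simp add: weight_sym)

lemma dirichlet_nonneg: "0 \<le> dirichlet w f f"
  by (simp add: dirichlet_def sum_nonneg weight_nonneg)

text \<open>Summation by parts: the two halves of \<open>g x - g y\<close> contribute equally by the symmetry of \<open>w\<close>.\<close>

lemma green_formula:
  "dirichlet w f g = (\<Sum>x\<in>UNIV. g x * (\<Sum>y\<in>UNIV. w x y * (f x - f y)))"
proof -
  let ?S = "\<Sum>x\<in>UNIV. \<Sum>y\<in>UNIV. w x y * ((f x - f y) * g x)"
  have "(\<Sum>x\<in>UNIV. \<Sum>y\<in>UNIV. w x y * ((f x - f y) * g y))
      = (\<Sum>x\<in>UNIV. \<Sum>y\<in>UNIV. w x y * ((f y - f x) * g x))"
    by (rule sum_swap_weight)
  also have "\<dots> = (\<Sum>x\<in>UNIV. \<Sum>y\<in>UNIV. - (w x y * ((f x - f y) * g x)))"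
    by (intro sum.cong refl) (simp add: algebra_simps)
  also have "\<dots> = - ?S"
    by (simp add: sum_negf)
  finally have "(\<Sum>x\<in>UNIV. \<Sum>y\<in>UNIV. w x y * ((f x - f y) * g x) - w x y * ((f x - f y) * g y)) = 2 * ?S"
    by (simp add: sum_subtractf)
  then have "dirichlet w f g = ?S"
    by (simp add: dirichlet_def right_diff_distrib)
  also have "\<dots> = (\<Sum>x\<in>UNIV. g x * (\<Sum>y\<in>UNIV. w x y * (f x - f y)))"
    by (simp add: sum_distrib_left ac_simps)
  finally show ?thesis .
qed

lemma dirichlet_eigenfunction:
  assumes "real_eigenfunction w \<mu> t f"
  shows "dirichlet w f g = t * (\<Sum>x\<in>UNIV. \<mu> x * (f x * g x))"
  using assms
  by (simp add: green_formula real_eigenfunction_def sum_distrib_left ac_simps)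

lemma eigenvalue_nonneg:
  assumes "real_eigenfunction w \<mu> t f" "f x \<noteq> 0"
  shows "0 \<le> t"
proof -
  have "0 < (\<Sum>x\<in>UNIV. \<mu> x * (f x * f x))"
    using assms(2) measure_pos
    by (intro sum_pos2[of _ x]) (auto simp: less_imp_le zero_less_mult_iff linorder_neq_iff)
  then show ?thesis
    using dirichlet_nonneg[of f] dirichlet_eigenfunction[OF assms(1), of f]
    by (simp add: zero_le_mult_iff)
qed

text \<open>By the symmetry of the Dirichlet form, the Laplacian is self-adjoint for the inner product
  weighted by \<open>\<mu>\<close>.\<close>

lemma eigenfunctions_orthogonal:
  assumes "real_eigenfunction w \<mu> s f" "real_eigenfunction w \<mu> t g" "s \<noteq> t"
  shows "(\<Sum>x\<in>UNIV. \<mu> x * (f x * g x)) = 0"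
proof -
  have "s * (\<Sum>x\<in>UNIV. \<mu> x * (f x * g x)) = t * (\<Sum>x\<in>UNIV. \<mu> x * (g x * f x))"
    using dirichlet_eigenfunction[OF assms(1), of g] dirichlet_eigenfunction[OF assms(2), of f]
    by (simp add: dirichlet_commute)
  then show ?thesis
    using assms(3) by (simp add: mult.commute[of "g _"])
qed

lemma real_eigenfunction_const: "real_eigenfunction w \<mu> 0 (\<lambda>x. c)"
  by (simp add: real_eigenfunction_def)

text \<open>A harmonic function has zero energy, so it does not vary along edges.\<close>

lemma harmonic_imp_const:
  assumes "graph_connected w" "real_eigenfunction w \<mu> 0 f"
  shows "f x = f y"
proof -
  have "(\<Sum>x\<in>UNIV. \<Sum>y\<in>UNIV. w x y * ((f x - f y) * (f x - f y))) = 0"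
    using dirichlet_eigenfunction[OF assms(2), of f] by (simp add: dirichlet_def)
  then have *: "w x y * ((f x - f y) * (f x - f y)) = 0" for x y
    by (simp add: sum_nonneg_eq_0_iff sum_nonneg weight_nonneg)
  have edge: "f u = f v" if "w u v > 0" for u v
    using *[of u v] that by auto
  have "(\<lambda>u v. w u v > 0)\<^sup>*\<^sup>* x y"
    using assms(1) by (simp add: graph_connected_def)
  then show ?thesis
    by (induction rule: rtranclp_induct) (use edge in auto)
qed

section \<open>The co-area inequality\<close>

lemma sum_weight_indicator:
  "(\<Sum>x\<in>UNIV. \<Sum>y\<in>UNIV. w x y * \<bar>indicator A x - indicator A y\<bar>) = 2 * cut_weight w A (- A)"
proof -
  have c: "cut_weight w A (- A) = (\<Sum>x\<in>UNIV. \<Sum>y\<in>UNIV. w x y * (indicator A x * indicator (- A) y))"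
    unfolding cut_weight_def
    by (intro sum.mono_neutral_cong_left ballI)
       (auto simp: sum_nonneg_eq_0_iff intro!: sum.mono_neutral_cong_left)
  have "(\<Sum>x\<in>UNIV. \<Sum>y\<in>UNIV. w x y * \<bar>indicator A x - indicator A y\<bar>)
      = (\<Sum>x\<in>UNIV. \<Sum>y\<in>UNIV. w x y * (indicator A x * indicator (- A) y)
            + w x y * (indicator A y * indicator (- A) x))"
    by (intro sum.cong refl) (auto simp: indicator_def)
  also have "\<dots> = 2 * cut_weight w A (- A)"
    unfolding c
    using sum_swap_weight[of "\<lambda>x y. indicator A x * indicator (- A) y"]
    by (simp add: sum.distrib)
  finally show ?thesis .
qed

text \<open>An isoperimetric inequality for the subsets of \<open>S\<close> passes to functions supported in \<open>S\<close>, because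
  such a function is a positive combination of indicators of a chain of subsets, along which the total
  variation is additive.  The induction peels off the lowest layer, the minimum
  over \<open>S\<close> times the indicator of \<open>S\<close>; the remainder also vanishes where the minimum is attained.
  The factor \<open>2\<close> is there because the sum on the right runs over ordered pairs.\<close>

lemma total_variation_ge:
  assumes "\<And>B. B \<subseteq> S \<Longrightarrow> h * sum m B \<le> cut_weight w B (- B)"
    and "\<And>x. 0 \<le> \<phi> x" and "\<And>x. x \<notin> S \<Longrightarrow> \<phi> x = 0"
  shows "2 * (h * (\<Sum>x\<in>UNIV. m x * \<phi> x)) \<le> (\<Sum>x\<in>UNIV. \<Sum>y\<in>UNIV. w x y * \<bar>\<phi> x - \<phi> y\<bar>)"
  using finite[of S] assms
proof (induction S arbitrary: \<phi> rule: finite_psubset_induct)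
  case (psubset S)
  show ?case
  proof (cases "S = {}")
    case True
    then show ?thesis
      using psubset.prems(3) by simp
  next
    case False
    define a where "a = Min (\<phi> ` S)"
    have "a \<in> \<phi> ` S" "\<And>x. x \<in> S \<Longrightarrow> a \<le> \<phi> x"
      using False by (auto simp: a_def)
    then obtain x0 where x0: "x0 \<in> S" "a = \<phi> x0" and le: "\<And>x. x \<in> S \<Longrightarrow> a \<le> \<phi> x"
      by auto
    have a0: "0 \<le> a"
      using x0 psubset.prems(2) by simp
    define \<psi> where "\<psi> x = \<phi> x - a * indicator S x" for x
    have IH: "2 * (h * (\<Sum>x\<in>UNIV. m x * \<psi> x)) \<le> (\<Sum>x\<in>UNIV. \<Sum>y\<in>UNIV. w x y * \<bar>\<psi> x - \<psi> y\<bar>)"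
    proof (rule psubset.IH[of "S - {x0}"])
      show "S - {x0} \<subset> S"
        using x0 by auto
      show "0 \<le> \<psi> x" for x
        using le[of x] psubset.prems(2)[of x] by (auto simp: \<psi>_def indicator_def)
      show "\<psi> x = 0" if "x \<notin> S - {x0}" for x
        using that x0 psubset.prems(3)[of x] by (auto simp: \<psi>_def indicator_def)
    qed (use psubset.prems(1) in auto)
    have variation: "\<bar>\<phi> x - \<phi> y\<bar> = \<bar>\<psi> x - \<psi> y\<bar> + a * \<bar>indicator S x - indicator S y\<bar>" for x y
      using le[of x] le[of y] a0 psubset.prems(3)[of x] psubset.prems(3)[of y]
      by (auto simp: \<psi>_def indicator_def)
    have "(\<Sum>x\<in>UNIV. m x * indicator S x) = sum m S"
      by (simp add: indicator_def sum.If_cases)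
    then have "(\<Sum>x\<in>UNIV. m x * \<phi> x) = (\<Sum>x\<in>UNIV. m x * \<psi> x) + a * sum m S"
      by (simp add: \<psi>_def right_diff_distrib sum_subtractf mult.left_commute[of _ a] flip: sum_distrib_left)
    moreover have "(\<Sum>x\<in>UNIV. \<Sum>y\<in>UNIV. w x y * \<bar>\<phi> x - \<phi> y\<bar>)
        = (\<Sum>x\<in>UNIV. \<Sum>y\<in>UNIV. w x y * \<bar>\<psi> x - \<psi> y\<bar>) + a * (2 * cut_weight w S (- S))"
      by (simp add: variation distrib_left sum.distrib mult.left_commute[of _ a]
          flip: sum_weight_indicator sum_distrib_left)
    moreover have "a * (h * sum m S) \<le> a * cut_weight w S (- S)"
      using psubset.prems(1)[of S] a0 by (simp add: mult_left_mono)
    ultimately show ?thesis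
      using IH by (simp add: algebra_simps)
  qed
qed

section \<open>The Cheeger bound for a function of small support\<close>

lemma cut_weight_nonneg: "0 \<le> cut_weight w A B"
  by (simp add: cut_weight_def sum_nonneg weight_nonneg)

lemma cheeger_mult_le_cut:
  assumes "\<And>x. 0 \<le> m x" and "sum \<nu> A \<le> sum \<nu> UNIV / 2"
  shows "cheeger w m \<nu> * sum m A \<le> cut_weight w A (- A)"
proof (cases "sum m A = 0")
  case True
  then show ?thesis
    by (simp add: cut_weight_nonneg)
next
  case False
  then have pos: "0 < sum m A" and "A \<noteq> {}"
    using assms(1) sum_nonneg[of A m] by (auto simp: order_less_le)
  then have "cheeger w m \<nu> \<le> cut_weight w A (- A) / sum m A"
    unfolding cheeger_def using assms(2) by (intro cINF_lower) auto
  then show ?thesis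
    using pos by (simp add: le_divide_eq)
qed

text \<open>The infimum of a set of nonnegative numbers is nonnegative if the set is nonempty, and
  here it is: of two vertices, the one of smaller \<open>\<nu>\<close>-measure is admissible.\<close>

lemma cheeger_nonneg:
  assumes "\<And>x. 0 \<le> m x" and "\<And>x. 0 \<le> \<nu> x"
  shows "0 \<le> cheeger w m \<nu>"
proof -
  obtain a b :: 'v where "a \<noteq> b"
    using two_vertices by blast
  then have "\<nu> a + \<nu> b \<le> sum \<nu> UNIV"
    using sum_mono2[of UNIV "{a, b}" \<nu>] assms(2) by simp
  then have "sum \<nu> {a} \<le> sum \<nu> UNIV / 2 \<or> sum \<nu> {b} \<le> sum \<nu> UNIV / 2"
    by auto
  then have ne: "{A. A \<noteq> {} \<and> sum \<nu> A \<le> sum \<nu> UNIV / 2} \<noteq> {}"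
    by blast
  show ?thesis
    unfolding cheeger_def
    by (intro cINF_greatest[OF ne] divide_nonneg_nonneg cut_weight_nonneg sum_nonneg assms(1))
qed

lemma vertex_degree_eq: "vertex_degree w x = (\<Sum>y\<in>UNIV. w x y)"
  unfolding vertex_degree_def by (intro sum.mono_neutral_left) (auto simp: weight_refl)

lemma vertex_degree_nonneg: "0 \<le> vertex_degree w x"
  by (simp add: vertex_degree_eq sum_nonneg weight_nonneg)

text \<open>Cauchy--Schwarz for \<open>u(x)\<^sup>2 - u(y)\<^sup>2 = (u(x) - u(y)) (u(x) + u(y))\<close>, followed by
  \<open>(u(x) + u(y))\<^sup>2 \<le> 2 u(x)\<^sup>2 + 2 u(y)\<^sup>2\<close>, whose weighted sum over all ordered pairs is four times the
  degree norm.\<close>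

lemma total_variation_square_le:
  "(\<Sum>x\<in>UNIV. \<Sum>y\<in>UNIV. w x y * \<bar>(u x)\<^sup>2 - (u y)\<^sup>2\<bar>)\<^sup>2
     \<le> 8 * dirichlet w u u * (\<Sum>x\<in>UNIV. vertex_degree w x * (u x)\<^sup>2)"
proof -
  define D where "D = (\<Sum>x\<in>UNIV. vertex_degree w x * (u x)\<^sup>2)"
  define p where "p = (\<lambda>(x, y). sqrt (w x y) * \<bar>u x - u y\<bar>)"
  define q where "q = (\<lambda>(x, y). sqrt (w x y) * \<bar>u x + u y\<bar>)"
  have "(\<Sum>x\<in>UNIV. \<Sum>y\<in>UNIV. w x y * \<bar>(u x)\<^sup>2 - (u y)\<^sup>2\<bar>) = (\<Sum>z\<in>UNIV. p z * q z)"
  proof -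
    have "w x y * \<bar>(u x)\<^sup>2 - (u y)\<^sup>2\<bar> = p (x, y) * q (x, y)" for x y
    proof -
      have "\<bar>(u x)\<^sup>2 - (u y)\<^sup>2\<bar> = \<bar>u x - u y\<bar> * \<bar>u x + u y\<bar>"
        by (simp add: power2_eq_square square_diff_square_factored abs_mult mult.commute)
      moreover have "w x y = sqrt (w x y) * sqrt (w x y)"
        by (simp add: weight_nonneg)
      ultimately show ?thesis
        unfolding p_def q_def by (simp add: weight_nonneg)
    qed
    then show ?thesis
      by (simp add: sum.cartesian_product split_beta flip: UNIV_Times_UNIV)
  qed
  moreover have "(\<Sum>z\<in>UNIV. (p z)\<^sup>2) = 2 * dirichlet w u u"
    by (simp add: p_def dirichlet_def sum.cartesian_product split_beta power_mult_distrib
        weight_nonneg flip: UNIV_Times_UNIV power2_eq_square)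
  moreover have "(\<Sum>z\<in>UNIV. (q z)\<^sup>2) \<le> 4 * D"
  proof -
    have "(\<Sum>z\<in>UNIV. (q z)\<^sup>2) = (\<Sum>x\<in>UNIV. \<Sum>y\<in>UNIV. w x y * (u x + u y)\<^sup>2)"
      by (simp add: q_def sum.cartesian_product split_beta power_mult_distrib
          weight_nonneg flip: UNIV_Times_UNIV)
    also have "\<dots> \<le> (\<Sum>x\<in>UNIV. \<Sum>y\<in>UNIV. 2 * (w x y * (u x)\<^sup>2) + 2 * (w x y * (u y)\<^sup>2))"
    proof (intro sum_mono)
      fix x y
      have "(u x + u y)\<^sup>2 \<le> 2 * (u x)\<^sup>2 + 2 * (u y)\<^sup>2"
        using zero_le_power2[of "u x - u y"] by (simp add: power2_sum power2_diff)
      from mult_left_mono[OF this weight_nonneg[of x y]]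
      show "w x y * (u x + u y)\<^sup>2 \<le> 2 * (w x y * (u x)\<^sup>2) + 2 * (w x y * (u y)\<^sup>2)"
        by (simp add: algebra_simps)
    qed
    also have "\<dots> = 4 * (\<Sum>x\<in>UNIV. \<Sum>y\<in>UNIV. w x y * (u x)\<^sup>2)"
      using sum_swap_weight[of "\<lambda>x y. (u x)\<^sup>2"]
      by (simp add: sum.distrib flip: sum_distrib_left)
    also have "\<dots> = 4 * D"
      by (simp add: D_def vertex_degree_eq sum_distrib_right)
    finally show ?thesis .
  qed
  ultimately have "(\<Sum>x\<in>UNIV. \<Sum>y\<in>UNIV. w x y * \<bar>(u x)\<^sup>2 - (u y)\<^sup>2\<bar>)\<^sup>2 \<le> 2 * dirichlet w u u * (4 * D)"
    using Cauchy_Schwarz_ineq_sum[of p q UNIV] dirichlet_nonneg[of u]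
    by (smt (verit) mult_left_mono)
  then show ?thesis
    by (simp add: D_def)
qed

text \<open>The total variation of \<open>u\<^sup>2\<close> is bounded below once with the measure \<open>\<mu>\<close> and once with the
  degree measure, and the product of the two bounds is compared with the Cauchy--Schwarz bound
  for its square, where the degree norm cancels.\<close>

lemma dirichlet_ge_cheeger_product:
  assumes "\<And>x. 0 \<le> \<nu> x" and half: "sum \<nu> {x. u x \<noteq> 0} \<le> sum \<nu> UNIV / 2"
  shows "1 / 2 * cheeger w \<mu> \<nu> * cheeger w (vertex_degree w) \<nu> * (\<Sum>x\<in>UNIV. \<mu> x * (u x)\<^sup>2)
           \<le> dirichlet w u u"
proof -
  define Q where "Q = (\<Sum>x\<in>UNIV. \<Sum>y\<in>UNIV. w x y * \<bar>(u x)\<^sup>2 - (u y)\<^sup>2\<bar>)"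
  define D where "D = (\<Sum>x\<in>UNIV. vertex_degree w x * (u x)\<^sup>2)"
  define M where "M = (\<Sum>x\<in>UNIV. \<mu> x * (u x)\<^sup>2)"
  define h where "h = cheeger w \<mu> \<nu>"
  define k where "k = cheeger w (vertex_degree w) \<nu>"
  have \<mu>0: "0 \<le> \<mu> x" for x
    using measure_pos[of x] by simp
  have admissible: "sum \<nu> B \<le> sum \<nu> UNIV / 2" if "B \<subseteq> {x. u x \<noteq> 0}" for B
    using sum_mono2[of "{x. u x \<noteq> 0}" B \<nu>] that assms(1) half by force
  have QM: "2 * (h * M) \<le> Q"
    unfolding Q_def M_def h_def
    by (rule total_variation_ge[where S = "{x. u x \<noteq> 0}"])
       (auto intro!: cheeger_mult_le_cut \<mu>0 admissible)
  have QD: "2 * (k * D) \<le> Q"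
    unfolding Q_def D_def k_def
    by (rule total_variation_ge[where S = "{x. u x \<noteq> 0}"])
       (auto intro!: cheeger_mult_le_cut vertex_degree_nonneg admissible)
  have nonneg: "0 \<le> h" "0 \<le> k" "0 \<le> M" "0 \<le> D"
    by (auto simp: h_def k_def M_def D_def \<mu>0 vertex_degree_nonneg assms(1)
        intro!: cheeger_nonneg sum_nonneg)
  have Q2: "Q\<^sup>2 \<le> 8 * dirichlet w u u * D"
    unfolding Q_def D_def by (rule total_variation_square_le)
  have "1 / 2 * h * k * M \<le> dirichlet w u u"
  proof (cases "D = 0")
    case True
    then have "Q = 0"
      using Q2 by simp
    moreover have "0 \<le> h * M"
      using nonneg by simp
    ultimately have "h * M = 0"
      using QM by linarith
    then show ?thesis
      using dirichlet_nonneg[of u] by auto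
  next
    case False
    have "2 * (h * M) * (2 * (k * D)) \<le> Q * Q"
      by (intro mult_mono QM QD order_trans[OF _ QM]) (simp_all add: nonneg)
    then have "(1 / 2 * h * k * M) * D \<le> dirichlet w u u * D"
      using Q2 by (simp add: power2_eq_square algebra_simps)
    then show ?thesis
      using False nonneg(4) by (simp add: mult_le_cancel_right)
  qed
  then show ?thesis
    by (simp add: h_def k_def M_def)
qed

end

section \<open>Shifting an eigenfunction by a median\<close>

text \<open>The least value \<open>c\<close> of \<open>f\<close> with \<open>f > c\<close> of at most half the measure is a median: for the next
  smaller value \<open>c'\<close>, the set \<open>f > c'\<close> has more than half of the measure, and \<open>f < c\<close> is the complement of that set.\<close>

lemma weighted_median_exists:
  fixes f \<nu> :: "'v::finite \<Rightarrow> real"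
  assumes "\<And>x. 0 \<le> \<nu> x"
  obtains c where "sum \<nu> {x. c < f x} \<le> sum \<nu> UNIV / 2" "sum \<nu> {x. f x < c} \<le> sum \<nu> UNIV / 2"
proof -
  define C where "C = {c \<in> range f. sum \<nu> {x. c < f x} \<le> sum \<nu> UNIV / 2}"
  have half: "0 \<le> sum \<nu> UNIV / 2"
    using assms by (simp add: sum_nonneg)
  have empty: "{x. Max (range f) < f x} = {}"
    by (auto simp: not_less)
  have "sum \<nu> {x. Max (range f) < f x} \<le> sum \<nu> UNIV / 2"
    unfolding empty using half by simp
  moreover have "Max (range f) \<in> range f"
    by (intro Max_in) simp_all
  ultimately have "Max (range f) \<in> C"
    unfolding C_def by blast
  then have C: "finite C" "C \<noteq> {}"
    unfolding C_def by (simp, blast)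
  define c where "c = Min C"
  have "c \<in> C"
    using C by (simp add: c_def)
  moreover have "sum \<nu> {x. f x < c} \<le> sum \<nu> UNIV / 2"
  proof (cases "{x. f x < c} = {}")
    case True
    then show ?thesis
      using half by (simp del: Collect_empty_eq)
  next
    case False
    define c' where "c' = Max (f ` {x. f x < c})"
    have "c' \<in> f ` {x. f x < c}"
      unfolding c'_def using False by (intro Max_in) auto
    moreover have le: "f x \<le> c'" if "f x < c" for x
      unfolding c'_def using that by (intro Max_ge) auto
    ultimately have "c' < c" "c' \<in> range f" and eq: "{x. f x < c} = - {x. c' < f x}"
      by (auto simp: not_less dest: le)
    have "c' \<notin> C"
      using Min_le[OF C(1), of c'] \<open>c' < c\<close> by (auto simp: c_def)
    then have "\<not> sum \<nu> {x. c' < f x} \<le> sum \<nu> UNIV / 2"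
      using \<open>c' \<in> range f\<close> unfolding C_def by blast
    then show ?thesis
      using sum.subset_diff[of "{x. c' < f x}" UNIV \<nu>] unfolding eq
      by (simp add: Compl_eq_Diff_UNIV)
  qed
  ultimately show thesis
    using that unfolding C_def by blast
qed

text \<open>The two sides agree unless \<open>a\<close> and \<open>b\<close> have opposite signs; then the left-hand side is
  \<open>a * a + b * b\<close>, and the right-hand side has the additional term \<open>- 2 * a * b \<ge> 0\<close>.\<close>

lemma square_diff_pos_neg_parts_le:
  fixes a b :: real
  shows "(max a 0 - max b 0) * (max a 0 - max b 0) + (max (- a) 0 - max (- b) 0) * (max (- a) 0 - max (- b) 0)
           \<le> (a - b) * (a - b)"
proof -
  consider "0 \<le> a" "0 \<le> b" | "a \<le> 0" "b \<le> 0" | "0 \<le> a" "b \<le> 0" | "a \<le> 0" "0 \<le> b"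
    by linarith
  then show ?thesis
  proof cases
    case 3
    then have "a * b \<le> 0"
      by (simp add: mult_nonneg_nonpos)
    then show ?thesis
      using 3 by (simp add: max_def algebra_simps)
  next
    case 4
    then have "a * b \<le> 0"
      by (simp add: mult_nonpos_nonneg)
    then show ?thesis
      using 4 by (simp add: max_def algebra_simps)
  qed (auto simp: max_def algebra_simps)
qed

context weighted_graph
begin

lemma dirichlet_pos_neg_parts_le:
  "dirichlet w (\<lambda>x. max (g x) 0) (\<lambda>x. max (g x) 0) + dirichlet w (\<lambda>x. max (- g x) 0) (\<lambda>x. max (- g x) 0)
     \<le> dirichlet w g g"
  unfolding dirichlet_def add_divide_distrib[symmetric] sum.distrib[symmetric] distrib_left[symmetric]
  by (intro divide_right_mono sum_mono mult_left_mono square_diff_pos_neg_parts_le weight_nonneg) simp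

text \<open>Since \<open>t \<noteq> 0\<close>, the eigenfunction \<open>f\<close> is orthogonal to the constants, so among its shifts it has
  the least norm: \<open>\<parallel>f - c\<parallel>\<^sup>2 = \<parallel>f\<parallel>\<^sup>2 + c\<^sup>2 \<mu>(V)\<close>.\<close>

lemma positive_eigenvalue_ge:
  assumes "\<And>x. 0 \<le> \<nu> x" and ef: "real_eigenfunction w \<mu> t f" and "f z \<noteq> 0" and "t \<noteq> 0"
  shows "1 / 2 * cheeger w \<mu> \<nu> * cheeger w (vertex_degree w) \<nu> \<le> t"
proof -
  obtain c where c: "sum \<nu> {x. c < f x} \<le> sum \<nu> UNIV / 2" "sum \<nu> {x. f x < c} \<le> sum \<nu> UNIV / 2"
    using weighted_median_exists[of \<nu> f] assms(1) by blast
  define K where "K = 1 / 2 * cheeger w \<mu> \<nu> * cheeger w (vertex_degree w) \<nu>"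
  define g where "g x = f x - c" for x
  define N where "N u = (\<Sum>x\<in>UNIV. \<mu> x * (u x)\<^sup>2)" for u :: "'v \<Rightarrow> real"
  have "{x. max (g x) 0 \<noteq> 0} = {x. c < f x}" "{x. max (- g x) 0 \<noteq> 0} = {x. f x < c}"
    by (auto simp: g_def max_def)
  then have "K * N (\<lambda>x. max (g x) 0) + K * N (\<lambda>x. max (- g x) 0)
      \<le> dirichlet w (\<lambda>x. max (g x) 0) (\<lambda>x. max (g x) 0)
        + dirichlet w (\<lambda>x. max (- g x) 0) (\<lambda>x. max (- g x) 0)"
    unfolding K_def N_def
    using c by (intro add_mono dirichlet_ge_cheeger_product assms(1)) simp_all
  also have "\<dots> \<le> dirichlet w g g"
    by (rule dirichlet_pos_neg_parts_le)
  also have "\<dots> = dirichlet w f f"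
    by (simp add: g_def[abs_def] dirichlet_shift)
  also have "\<dots> = t * N f"
    using dirichlet_eigenfunction[OF ef, of f] by (simp add: N_def power2_eq_square)
  finally have "K * (N (\<lambda>x. max (g x) 0) + N (\<lambda>x. max (- g x) 0)) \<le> t * N f"
    by (simp add: distrib_left)
  moreover have "N (\<lambda>x. max (g x) 0) + N (\<lambda>x. max (- g x) 0) = N g"
    unfolding N_def sum.distrib[symmetric] by (intro sum.cong refl) (simp add: max_def)
  moreover have "N f \<le> N g"
  proof -
    have "(\<Sum>x\<in>UNIV. \<mu> x * (f x * 1)) = 0"
      using eigenfunctions_orthogonal[OF ef real_eigenfunction_const[of 1] assms(4)] .
    moreover have "N g = N f - 2 * c * (\<Sum>x\<in>UNIV. \<mu> x * (f x * 1)) + c\<^sup>2 * sum \<mu> UNIV"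
      by (simp add: N_def g_def power2_diff algebra_simps sum.distrib sum_subtractf
          sum_distrib_left sum_distrib_right)
    ultimately show ?thesis
      using measure_pos by (simp add: sum_nonneg less_imp_le)
  qed
  moreover have "0 < N f"
    unfolding N_def using assms(3) measure_pos
    by (intro sum_pos2[of _ z]) (auto simp: less_imp_le)
  moreover have "0 \<le> K"
    using assms(1) measure_pos
    by (auto simp: K_def vertex_degree_nonneg less_imp_le intro!: mult_nonneg_nonneg cheeger_nonneg)
  ultimately have "K * N f \<le> t * N f"
    by (smt (verit) mult_left_mono)
  then show ?thesis
    using \<open>0 < N f\<close> by (simp add: K_def)
qed

section \<open>Existence of a nonzero eigenvalue\<close>

text \<open>The Rayleigh quotient is invariant under scaling, so its minimum over the Euclidean unit
  sphere of the hyperplane of functions of \<open>\<mu>\<close>-mean zero, which is compact, is a minimum over the whole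
  hyperplane.  With two vertices there is such a function other than \<open>0\<close>.\<close>

lemma rayleigh_minimizer:
  obtains f :: "'v \<Rightarrow> real" and t where "(\<Sum>x\<in>UNIV. \<mu> x * f x) = 0" "\<exists>x. f x \<noteq> 0"
    "dirichlet w f f = t * (\<Sum>x\<in>UNIV. \<mu> x * (f x)\<^sup>2)"
    "\<And>g. (\<Sum>x\<in>UNIV. \<mu> x * g x) = 0 \<Longrightarrow> t * (\<Sum>x\<in>UNIV. \<mu> x * (g x)\<^sup>2) \<le> dirichlet w g g"
proof -
  define N where "N u = (\<Sum>x\<in>UNIV. \<mu> x * (u x)\<^sup>2)" for u :: "'v \<Rightarrow> real"
  define H where "H = {v :: real ^ 'v. (\<Sum>x\<in>UNIV. \<mu> x * v $ x) = 0}"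
  define R where "R v = dirichlet w (($) v) (($) v) / N (($) v)" for v :: "real ^ 'v"
  have Npos: "0 < N u" if "u x \<noteq> 0" for u x
    unfolding N_def using that measure_pos
    by (intro sum_pos2[of _ x]) (auto simp: less_imp_le)
  have NposV: "0 < N (($) v)" if "v \<noteq> 0" for v :: "real ^ 'v"
    using that Npos by (auto simp: vec_eq_iff)
  have "closed H"
    unfolding H_def by (intro closed_Collect_eq continuous_intros)
  then have comp: "compact (sphere 0 1 \<inter> H)"
    by (intro compact_Int_closed compact_sphere)
  have normalize: "v /\<^sub>R norm v \<in> sphere 0 1 \<inter> H" if "v \<in> H" "v \<noteq> 0" for v
  proof -
    have "(\<Sum>x\<in>UNIV. \<mu> x * (v /\<^sub>R norm v) $ x) = inverse (norm v) * (\<Sum>x\<in>UNIV. \<mu> x * v $ x)"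
      by (simp add: sum_distrib_left ac_simps)
    then show ?thesis
      using that by (simp add: H_def)
  qed
  obtain a b :: 'v where ab: "a \<noteq> b"
    using two_vertices by blast
  define v0 :: "real ^ 'v" where "v0 = (\<chi> x. if x = a then 1 / \<mu> a else if x = b then - 1 / \<mu> b else 0)"
  have "(\<Sum>x\<in>UNIV. \<mu> x * v0 $ x) = (\<Sum>x\<in>{a, b}. \<mu> x * v0 $ x)"
    by (intro sum.mono_neutral_right) (auto simp: v0_def)
  also have "\<dots> = 0"
    using ab measure_pos[of a] measure_pos[of b] by (auto simp: v0_def)
  finally have "v0 \<in> H"
    by (simp add: H_def)
  moreover have "v0 $ a \<noteq> 0"
    using measure_pos[of a] by (simp add: v0_def)
  then have "v0 \<noteq> 0"
    by auto
  ultimately have ne: "sphere 0 1 \<inter> H \<noteq> {}"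
    using normalize[of v0] by blast
  have "N (($) v) \<noteq> 0" if "v \<in> sphere 0 1 \<inter> H" for v
    using that NposV[of v] by (cases "v = 0") simp_all
  then have "continuous_on (sphere 0 1 \<inter> H) R"
    unfolding R_def dirichlet_def N_def by (intro continuous_intros ballI) simp_all
  from continuous_attains_inf[OF comp ne this]
  obtain v where v: "v \<in> sphere 0 1 \<inter> H" and min: "\<And>u. u \<in> sphere 0 1 \<inter> H \<Longrightarrow> R v \<le> R u"
    by auto
  then have "v \<noteq> 0"
    by auto
  have scale: "R (r *\<^sub>R u) = R u" if "r \<noteq> 0" for r and u :: "real ^ 'v"
  proof -
    have "dirichlet w (($) (r *\<^sub>R u)) (($) (r *\<^sub>R u)) = r\<^sup>2 * dirichlet w (($) u) (($) u)"
      by (simp add: dirichlet_def sum_distrib_left algebra_simps power2_eq_square)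
    moreover have "N (($) (r *\<^sub>R u)) = r\<^sup>2 * N (($) u)"
      by (simp add: N_def sum_distrib_left power_mult_distrib ac_simps)
    ultimately show ?thesis
      using that by (simp add: R_def)
  qed
  show thesis
  proof (rule that[of "($) v" "R v"])
    show "(\<Sum>x\<in>UNIV. \<mu> x * v $ x) = 0"
      using v by (simp add: H_def)
    show "\<exists>x. v $ x \<noteq> 0"
      using \<open>v \<noteq> 0\<close> by (auto simp: vec_eq_iff)
    show "dirichlet w (($) v) (($) v) = R v * (\<Sum>x\<in>UNIV. \<mu> x * (v $ x)\<^sup>2)"
      using NposV[OF \<open>v \<noteq> 0\<close>] by (simp add: R_def N_def)
    show "R v * (\<Sum>x\<in>UNIV. \<mu> x * (g x)\<^sup>2) \<le> dirichlet w g g" if g: "(\<Sum>x\<in>UNIV. \<mu> x * g x) = 0" for g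
    proof (cases "\<exists>x. g x \<noteq> 0")
      case False
      then show ?thesis
        using dirichlet_nonneg[of g] by simp
    next
      case True
      define u :: "real ^ 'v" where "u = (\<chi> x. g x)"
      have u: "u \<in> H" "u \<noteq> 0" "($) u = g"
        using g True by (auto simp: u_def H_def vec_eq_iff)
      have "R v \<le> R u"
        using min[OF normalize[OF u(1,2)]] scale[of "inverse (norm u)" u] u(2) by simp
      then show ?thesis
        using NposV[OF u(2)] by (simp add: R_def u(3) pos_le_divide_eq N_def)
    qed
  qed
qed

text \<open>The minimizer satisfies the eigenvalue equation because the nonnegative quadratic form
  \<open>E(g) - t \<parallel>g\<parallel>\<^sup>2\<close> vanishes at \<open>f\<close>, so that the associated bilinear form vanishes on \<open>f\<close> and
  every \<open>g\<close> orthogonal to the constants.  Constants are in its kernel as well,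
  and then testing against the functions supported at a single vertex gives the equation there.\<close>

lemma nonzero_eigenvalue_exists:
  assumes "graph_connected w"
  obtains f t where "real_eigenfunction w \<mu> t f" "\<exists>x. f x \<noteq> 0" "t \<noteq> 0"
proof -
  obtain f t where mean: "(\<Sum>x\<in>UNIV. \<mu> x * f x) = 0" and ne: "\<exists>x. f x \<noteq> 0"
    and eq: "dirichlet w f f = t * (\<Sum>x\<in>UNIV. \<mu> x * (f x)\<^sup>2)"
    and le: "\<And>g. (\<Sum>x\<in>UNIV. \<mu> x * g x) = 0 \<Longrightarrow> t * (\<Sum>x\<in>UNIV. \<mu> x * (g x)\<^sup>2) \<le> dirichlet w g g"
    using rayleigh_minimizer by blast
  define B where "B g = dirichlet w f g - t * (\<Sum>x\<in>UNIV. \<mu> x * (f x * g x))" for g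
  have B_mean_zero: "B g = 0" if g: "(\<Sum>x\<in>UNIV. \<mu> x * g x) = 0" for g
  proof -
    define q where "q = dirichlet w g g - t * (\<Sum>x\<in>UNIV. \<mu> x * (g x)\<^sup>2)"
    have nonneg: "0 \<le> 2 * s * B g + s\<^sup>2 * q" for s
    proof -
      have "(\<Sum>x\<in>UNIV. \<mu> x * (f x + s * g x)) = (\<Sum>x\<in>UNIV. \<mu> x * f x) + s * (\<Sum>x\<in>UNIV. \<mu> x * g x)"
        by (simp add: algebra_simps sum.distrib sum_distrib_left)
      then have "t * (\<Sum>x\<in>UNIV. \<mu> x * (f x + s * g x)\<^sup>2)
          \<le> dirichlet w (\<lambda>x. f x + s * g x) (\<lambda>x. f x + s * g x)"
        using mean g by (intro le) simp
      moreover have "(\<Sum>x\<in>UNIV. \<mu> x * (f x + s * g x)\<^sup>2)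
          = (\<Sum>x\<in>UNIV. \<mu> x * (f x)\<^sup>2) + 2 * s * (\<Sum>x\<in>UNIV. \<mu> x * (f x * g x))
            + s\<^sup>2 * (\<Sum>x\<in>UNIV. \<mu> x * (g x)\<^sup>2)"
        by (simp add: power2_sum power_mult_distrib algebra_simps sum.distrib sum_distrib_left)
      ultimately show ?thesis
        using eq by (simp add: dirichlet_square_add B_def q_def algebra_simps)
    qed
    have "0 \<le> q"
      using le[OF g] by (simp add: q_def)
    \<comment> \<open>A point near the minimizer \<open>- B g / q\<close>, with a denominator that cannot vanish; the value there is
      negative unless \<open>B g = 0\<close>.\<close>
    define s where "s = - B g / (q + 1)"
    have "B g = - (s * (q + 1))"
      using \<open>0 \<le> q\<close> by (simp add: s_def)
    have "2 * s * B g + s\<^sup>2 * q = - (s\<^sup>2 * (q + 2))"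
      unfolding \<open>B g = - (s * (q + 1))\<close> by (simp add: algebra_simps power2_eq_square)
    then have "s\<^sup>2 * (q + 2) \<le> 0"
      using nonneg[of s] by simp
    then have "s = 0"
      using \<open>0 \<le> q\<close> by (simp add: mult_le_0_iff)
    then show ?thesis
      using \<open>B g = - (s * (q + 1))\<close> by simp
  qed
  have B_zero: "B g = 0" for g
  proof -
    define c where "c = (\<Sum>x\<in>UNIV. \<mu> x * g x) / sum \<mu> UNIV"
    have "0 < sum \<mu> UNIV"
      using measure_pos by (intro sum_pos) auto
    moreover have "(\<Sum>x\<in>UNIV. \<mu> x * (g x - c)) = (\<Sum>x\<in>UNIV. \<mu> x * g x) - c * sum \<mu> UNIV"
      by (simp add: algebra_simps sum_subtractf sum_distrib_left)
    ultimately have "(\<Sum>x\<in>UNIV. \<mu> x * (g x - c)) = 0"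
      by (simp add: c_def)
    then have "B (\<lambda>x. g x - c) = 0"
      by (rule B_mean_zero)
    moreover have "(\<Sum>x\<in>UNIV. \<mu> x * (f x * (g x - c)))
        = (\<Sum>x\<in>UNIV. \<mu> x * (f x * g x)) - c * (\<Sum>x\<in>UNIV. \<mu> x * f x)"
      by (simp add: algebra_simps sum_subtractf sum_distrib_left)
    ultimately show ?thesis
      using mean by (simp add: B_def dirichlet_def)
  qed
  have ef: "real_eigenfunction w \<mu> t f"
    unfolding real_eigenfunction_def
  proof
    fix x
    define e :: "'v \<Rightarrow> real" where "e y = (if y = x then 1 else 0)" for y
    have "\<mu> y * (f y * e y) = (if y = x then \<mu> x * f x else 0)"
      and "e y * a = (if y = x then a else 0)" for y a
      by (simp_all add: e_def)
    then show "(\<Sum>y\<in>UNIV. w x y * (f x - f y)) = t * (\<mu> x * f x)"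
      using B_zero[of e] by (simp add: B_def green_formula)
  qed
  moreover have "t \<noteq> 0"
  proof
    assume "t = 0"
    then have const: "f x = f y" for x y
      using harmonic_imp_const[OF assms] ef by blast
    then have "(\<Sum>y\<in>UNIV. \<mu> y * f y) = sum \<mu> UNIV * f x" for x
      unfolding sum_distrib_right by (intro sum.cong refl) (metis const)
    moreover have "0 < sum \<mu> UNIV"
      using measure_pos by (intro sum_pos) auto
    ultimately show False
      using mean ne by auto
  qed
  ultimately show thesis
    using that ne by blast
qed

section \<open>The list of eigenvalues\<close>

text \<open>The coefficients of the Laplacian are real, so real and imaginary parts decouple.\<close>

lemma eigenspace_iff:
  "f \<in> eigenspace w \<mu> t \<longleftrightarrow>
     real_eigenfunction w \<mu> t (\<lambda>x. Re (f $ x)) \<and> real_eigenfunction w \<mu> t (\<lambda>x. Im (f $ x))"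
proof -
  have *: "1 / complex_of_real (\<mu> x) * z = of_real t * a \<longleftrightarrow>
      Re z = t * (\<mu> x * Re a) \<and> Im z = t * (\<mu> x * Im a)" for x z a
    using measure_pos[of x] by (auto simp: complex_eq_iff divide_simps ac_simps)
  show ?thesis
    unfolding eigenspace_def laplacian_def vec_eq_iff real_eigenfunction_def mem_Collect_eq
      vec_lambda_beta vector_smult_component * all_conj_distrib
    by simp
qed

lemma spectrum_iff:
  "t \<in> laplacian_spectrum w \<mu> \<longleftrightarrow> (\<exists>f. real_eigenfunction w \<mu> t f \<and> (\<exists>x. f x \<noteq> 0))"
proof
  assume "t \<in> laplacian_spectrum w \<mu>"
  then obtain f where f: "f \<in> eigenspace w \<mu> t" "f \<noteq> 0"
    by (auto simp: laplacian_spectrum_def)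
  then obtain x where "Re (f $ x) \<noteq> 0 \<or> Im (f $ x) \<noteq> 0"
    by (auto simp: vec_eq_iff complex_eq_iff)
  then show "\<exists>f. real_eigenfunction w \<mu> t f \<and> (\<exists>x. f x \<noteq> 0)"
    using f(1) unfolding eigenspace_iff by blast
next
  assume "\<exists>f. real_eigenfunction w \<mu> t f \<and> (\<exists>x. f x \<noteq> 0)"
  then obtain f x where f: "real_eigenfunction w \<mu> t f" "f x \<noteq> 0"
    by blast
  have "(\<chi> x. complex_of_real (f x)) \<in> eigenspace w \<mu> t"
    using f(1) unfolding eigenspace_iff by (simp add: real_eigenfunction_def)
  moreover have "(\<chi> x. complex_of_real (f x)) \<noteq> 0"
    using f(2) by (auto simp: vec_eq_iff)
  ultimately show "t \<in> laplacian_spectrum w \<mu>"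
    by (auto simp: laplacian_spectrum_def)
qed

text \<open>Multiplying by the square root of \<open>\<mu>\<close> turns the weighted inner product into the standard one, where
  a set of pairwise orthogonal vectors is finite.\<close>

lemma finite_spectrum: "finite (laplacian_spectrum w \<mu>)"
proof -
  have "\<forall>t \<in> laplacian_spectrum w \<mu>. \<exists>f. real_eigenfunction w \<mu> t f \<and> (\<exists>x. f x \<noteq> 0)"
    by (simp add: spectrum_iff)
  then obtain F where F: "\<And>t. t \<in> laplacian_spectrum w \<mu> \<Longrightarrow>
      real_eigenfunction w \<mu> t (F t) \<and> (\<exists>x. F t x \<noteq> 0)"
    unfolding bchoice_iff by blast
  define v :: "real \<Rightarrow> real ^ 'v" where "v t = (\<chi> x. sqrt (\<mu> x) * F t x)" for t
  have orth: "v s \<bullet> v t = 0"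
    if "s \<in> laplacian_spectrum w \<mu>" "t \<in> laplacian_spectrum w \<mu>" "s \<noteq> t" for s t
  proof -
    have "sqrt (\<mu> x) * F s x * (sqrt (\<mu> x) * F t x) = (sqrt (\<mu> x))\<^sup>2 * (F s x * F t x)" for x
      by (simp add: power2_eq_square)
    then have eq: "sqrt (\<mu> x) * F s x * (sqrt (\<mu> x) * F t x) = \<mu> x * (F s x * F t x)" for x
      using measure_pos[of x] by simp
    show ?thesis
      using eigenfunctions_orthogonal[of s "F s" t "F t"] F that by (simp add: v_def inner_vec_def eq)
  qed
  have nz: "v t \<noteq> 0" if t: "t \<in> laplacian_spectrum w \<mu>" for t
  proof -
    obtain x where "F t x \<noteq> 0"
      using F[OF t] by blast
    then have "v t $ x \<noteq> 0"
      using measure_pos[of x] by (simp add: v_def)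
    then show ?thesis
      by auto
  qed
  have "inj_on v (laplacian_spectrum w \<mu>)"
    using orth nz by (metis inj_onI inner_eq_zero_iff)
  moreover have "finite (v ` laplacian_spectrum w \<mu>)"
    using orth by (intro pairwise_orthogonal_imp_finite) (auto simp: pairwise_def orthogonal_def)
  ultimately show ?thesis
    by (simp add: finite_image_iff)
qed

lemma zero_in_spectrum: "0 \<in> laplacian_spectrum w \<mu>"
  unfolding spectrum_iff using real_eigenfunction_const[of 1] by fastforce

lemma dim_eigenspace_0:
  assumes "graph_connected w"
  shows "vec.dim (eigenspace w \<mu> 0) = 1"
proof -
  have "eigenspace w \<mu> 0 = vec.span {1}"
  proof (intro equalityI subsetI)
    fix f
    assume "f \<in> eigenspace w \<mu> 0"
    then have "f $ x = f $ y" for x y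
      unfolding eigenspace_iff using harmonic_imp_const[OF assms] by (metis complex_eq_iff)
    then have "f = f $ undefined *s 1"
      by (simp add: vec_eq_iff)
    then show "f \<in> vec.span {1}"
      by (metis vec.span_base vec.span_scale singletonI)
  next
    fix f :: "complex ^ 'v"
    assume "f \<in> vec.span {1}"
    then obtain c where "f = c *s 1"
      by (auto simp: vec.span_singleton)
    then show "f \<in> eigenspace w \<mu> 0"
      by (simp add: eigenspace_iff real_eigenfunction_const)
  qed
  moreover have "(1 :: complex ^ 'v) \<noteq> 0"
    by (simp add: vec_eq_iff)
  ultimately show ?thesis
    by simp
qed

text \<open>The list begins with a single \<open>0\<close>, because \<open>0\<close> is the least eigenvalue and it is simple.  The
  least nonzero eigenvalue comes next, since its eigenspace has positive dimension.\<close>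

lemma second_eigenvalue:
  assumes "graph_connected w"
  shows "laplacian_eigenvalue w \<mu> 2 \<in> laplacian_spectrum w \<mu> - {0}"
proof -
  define S where "S = laplacian_spectrum w \<mu>"
  have S: "finite S" "0 \<in> S"
    by (simp_all add: S_def finite_spectrum zero_in_spectrum)
  have "0 \<le> t" if "t \<in> S" for t
    using that eigenvalue_nonneg unfolding S_def spectrum_iff by blast
  then have min: "Min S = 0"
    using S by (intro Min_eqI)
  obtain f s where "real_eigenfunction w \<mu> s f" "\<exists>x. f x \<noteq> 0" "s \<noteq> 0"
    using nonzero_eigenvalue_exists[OF assms] .
  then have "s \<in> S - {0}"
    by (auto simp: S_def spectrum_iff)
  then have ne: "S - {0} \<noteq> {}"
    by blast
  define t where "t = Min (S - {0})"
  have t: "t \<in> S - {0}"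
    unfolding t_def using S ne by (intro Min_in) auto
  have "sorted_list_of_set S = 0 # sorted_list_of_set (S - {0})"
    using sorted_list_of_set_nonempty[of S] S min by auto
  also have "sorted_list_of_set (S - {0}) = t # sorted_list_of_set (S - {0} - {t})"
    using sorted_list_of_set_nonempty[of "S - {0}"] S ne by (auto simp: t_def)
  finally have list: "sorted_list_of_set S = 0 # t # sorted_list_of_set (S - {0} - {t})" .
  have "vec.dim (eigenspace w \<mu> t) \<noteq> 0"
    using t by (auto simp: S_def laplacian_spectrum_def)
  then have "laplacian_eigenvalue w \<mu> 2 = t"
    using dim_eigenspace_0[OF assms] list
    by (simp add: laplacian_eigenvalue_def eigenvalue_list_def S_def nth_append)
  then show ?thesis
    using t by (simp add: S_def)
qed

end

theorem theorem1p2: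
  fixes w :: "'v::finite \<Rightarrow> 'v \<Rightarrow> real" and \<mu> \<nu> :: "'v \<Rightarrow> real"
  assumes "weighted_graph w \<mu>"
    and "graph_connected w"
    and "\<And>x. \<nu> x \<ge> 0"
  shows "laplacian_eigenvalue w \<mu> 2 \<ge> 1 / 2 * cheeger w \<mu> \<nu> * cheeger w (vertex_degree w) \<nu>"
proof -
  interpret weighted_graph w \<mu>
    by fact
  obtain f x where "real_eigenfunction w \<mu> (laplacian_eigenvalue w \<mu> 2) f" "f x \<noteq> 0"
    "laplacian_eigenvalue w \<mu> 2 \<noteq> 0"
    using second_eigenvalue[OF assms(2)] by (auto simp: spectrum_iff)
  with assms(3) show ?thesis
    by (rule positive_eigenvalue_ge)
qed

end
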